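(* There is an infinite strictly ascending chain $$\mathrm{Fin}<_{\mathrm{LT}}\mathrm{ED}_{\mathrm{fin}}[1]<_{\mathrm{LT}}\dots<_{\mathrm{LT}}\mathrm{ED}_{\mathrm{fin}}[m]<_{\mathrm{LT}}\mathrm{ED}_{\mathrm{fin}}[m+1]<_{\mathrm{LT}}\dots<_{\mathrm{LT}}\mathrm{ED}_{\mathrm{fin}}<_{\mathrm{LT}}\mathrm{Sum}_{1/n}$$ within the $\leq_{\mathrm{LT}}$-order on lower sets over $\omega$.
   Context: **Upper and lower sets.** An upper set is a nonempty family $\mathcal U\subseteq\mathcal P(\omega)$, closed upwards under $\subseteq$, with $\emptyset\notin\mathcal U$. A lower set is a family $\mathcal L\subseteq\mathcal P(\omega)$ whose dual $\mathcal L^*=\{\omega\setminus A:A\in\mathcal L\}$ is an upper set. **$\leq_{\mathrm{LT}}$ on upper and lower sets.** Fix a computable bijection $\langle-,-\rangle\colon\omega^2\to\omega$. For upper sets $\mathcal U,\mathcal V$ consider the following game between Merlin and the team Arthur–Nimue. Merlin first chooses $A\in\mathcal U$. At round $n=0,1,\dots$ Arthur either terminates the game with an output $u\in\omega$ (move $\langle1,u\rangle$) or makes a query; after a query Nimue chooses $B_n\in\mathcal V$ and Merlin replies with $x_{n+1}\in B_n$. Arthur sees only $x_1,\dots,x_n$ (not $A$ nor the $B_i$), and his strategy is a partial computable function $\omega^{<\omega}\rightharpoonup\omega$; Nimue sees the whole history and her strategy is arbitrary. The Arthur–Nimue strategy wins if every play following it terminates legally (after finitely many rounds) with output in $A$,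 or Merlin violates the rules first. $\mathcal U\leq_{\mathrm{LT}}\mathcal V$ iff Arthur–Nimue have a winning strategy. (This coincides with the order on the associated basic Lawvere–Tierney topologies in the Effective Topos.) For lower sets, $\mathcal H\leq_{\mathrm{LT}}\mathcal I$ iff $\mathcal H^*\leq_{\mathrm{LT}}\mathcal I^*$. $\mathcal H<_{\mathrm{LT}}\mathcal I$ means $\mathcal H\leq_{\mathrm{LT}}\mathcal I$ and $\mathcal I\not\leq_{\mathrm{LT}}\mathcal H$. **The lower sets.** $\mathrm{Fin}$ is the set of finite subsets of $\omega$. Partition $\omega$ into consecutive intervals $(I_a)_{a\in\omega}$, where $I_a$ has length $a$. For $m\geq1$, $\mathrm{ED}_{\mathrm{fin}}[m]$ is the set of all $A\subseteq\omega$ with $|A\cap I_n|\leq m$ for all but finitely many $n$; $\mathrm{ED}_{\mathrm{fin}}=\bigcup_m\mathrm{ED}_{\mathrm{fin}}[m]$. $\mathrm{Sum}_{1/n}$ is the set of all $A\subseteq\omega$ with $\sum_{n\in A,\,n>0}\frac1n<\infty$. *)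

theory Defs
  imports "HOL-Library.Nat_Bijection" "HOL-Analysis.Infinite_Sum"
begin

section \<open>Partial computable functions\<close>

datatype recf =
    Zero
  | Succ
  | Proj nat
  | Comp recf "recf list"
  | PrimRec recf recf
  | Mu recf

text \<open>\<open>eval f xs y\<close>: the partial recursive function \<open>f\<close> is defined with value \<open>y\<close> on the
  arguments \<open>xs\<close>. In \<open>PrimRec f g\<close> and \<open>Mu f\<close> the recursion, respectively search, variable is
  the first argument.\<close>

inductive eval :: "recf \<Rightarrow> nat list \<Rightarrow> nat \<Rightarrow> bool" where
  Zero: "eval Zero xs 0"
| Succ: "eval Succ [x] (Suc x)"
| Proj: "i < length xs \<Longrightarrow> eval (Proj i) xs (xs ! i)"
| Comp: "list_all2 (\<lambda>g y. eval g xs y) gs ys \<Longrightarrow> eval f ys z \<Longrightarrow> eval (Comp f gs) xs z"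
| PrimRec_0: "eval f xs y \<Longrightarrow> eval (PrimRec f g) (0 # xs) y"
| PrimRec_Suc: "eval (PrimRec f g) (n # xs) y \<Longrightarrow> eval g (n # y # xs) z
    \<Longrightarrow> eval (PrimRec f g) (Suc n # xs) z"
| Mu: "eval f (n # xs) 0 \<Longrightarrow> (\<forall>m<n. \<exists>y. eval f (m # xs) (Suc y)) \<Longrightarrow> eval (Mu f) xs n"

text \<open>Finite sequences are coded by numbers via \<^const>\<open>list_encode\<close>.\<close>

definition partial_computable :: "(nat list \<rightharpoonup> nat) \<Rightarrow> bool" where
  "partial_computable \<phi> \<longleftrightarrow>
     (\<exists>f. \<forall>xs y. \<phi> xs = Some y \<longleftrightarrow> eval f [list_encode xs] y)"


section \<open>Upper and lower sets\<close>

definition upper_set :: "nat set set \<Rightarrow> bool" where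
  "upper_set U \<longleftrightarrow> U \<noteq> {} \<and> (\<forall>A B. A \<in> U \<and> A \<subseteq> B \<longrightarrow> B \<in> U) \<and> {} \<notin> U"

definition dual :: "nat set set \<Rightarrow> nat set set" where
  "dual L = {UNIV - A | A. A \<in> L}"

definition lower_set :: "nat set set \<Rightarrow> bool" where
  "lower_set L \<longleftrightarrow> upper_set (dual L)"


section \<open>The game\<close>

text \<open>The fixed computable pairing is \<^const>\<open>prod_encode\<close>. Arthur's move \<open>\<langle>1,u\<rangle>\<close> ends the game
  with output \<open>u\<close>; every move \<open>\<langle>0,q\<rangle>\<close> is a query, with \<open>q\<close> carrying no meaning. All other
  moves, and being undefined, are illegal for Arthur.\<close>

definition query :: "nat \<Rightarrow> bool" where
  "query a \<longleftrightarrow> (\<exists>q. a = prod_encode (0, q))"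

definition terminate :: "nat \<Rightarrow> nat" where
  "terminate u = prod_encode (1, u)"

type_synonym arthur = "nat list \<rightharpoonup> nat"

text \<open>A completed round consists of Arthur's query, Nimue's set and Merlin's reply.\<close>

type_synonym round = "nat \<times> nat set \<times> nat"

text \<open>Nimue sees Merlin's initial set, the completed rounds and Arthur's current query.\<close>

type_synonym nimue = "nat set \<Rightarrow> round list \<Rightarrow> nat \<Rightarrow> nat set"

text \<open>A play is determined by Merlin's set \<open>A\<close> and his replies, where \<open>x n\<close> is the reply
  \<open>x\<^sub>n\<^sub>+\<^sub>1\<close> given in round \<open>n\<close>; hence in round \<open>n\<close> Arthur sees exactly \<open>map x [0..<n]\<close>. Values
  of the following functions beyond the first illegal or final move are irrelevant.\<close>

definition arthur_move :: "arthur \<Rightarrow> (nat \<Rightarrow> nat) \<Rightarrow> nat \<Rightarrow> nat option" where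
  "arthur_move \<alpha> x n = \<alpha> (map x [0..<n])"

primrec rounds :: "arthur \<Rightarrow> nimue \<Rightarrow> nat set \<Rightarrow> (nat \<Rightarrow> nat) \<Rightarrow> nat \<Rightarrow> round list" where
  "rounds \<alpha> \<nu> A x 0 = []"
| "rounds \<alpha> \<nu> A x (Suc n) =
    (let h = rounds \<alpha> \<nu> A x n; a = the (arthur_move \<alpha> x n)
     in h @ [(a, \<nu> A h a, x n)])"

definition nimue_move :: "arthur \<Rightarrow> nimue \<Rightarrow> nat set \<Rightarrow> (nat \<Rightarrow> nat) \<Rightarrow> nat \<Rightarrow> nat set" where
  "nimue_move \<alpha> \<nu> A x n = \<nu> A (rounds \<alpha> \<nu> A x n) (the (arthur_move \<alpha> x n))"

definition legal_query_round ::
    "nat set set \<Rightarrow> arthur \<Rightarrow> nimue \<Rightarrow> nat set \<Rightarrow> (nat \<Rightarrow> nat) \<Rightarrow> nat \<Rightarrow> bool" where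
  "legal_query_round V \<alpha> \<nu> A x n \<longleftrightarrow>
     (\<exists>a. arthur_move \<alpha> x n = Some a \<and> query a) \<and> nimue_move \<alpha> \<nu> A x n \<in> V"

text \<open>Every play reaches a round \<open>n\<close>, all earlier rounds being legal queries with legal replies,
  in which either Arthur terminates with an output in \<open>A\<close>, or Arthur and Nimue move legally and
  Merlin breaks the rules.\<close>

definition winning ::
    "nat set set \<Rightarrow> nat set set \<Rightarrow> arthur \<Rightarrow> nimue \<Rightarrow> bool" where
  "winning U V \<alpha> \<nu> \<longleftrightarrow>
     (\<forall>A\<in>U. \<forall>x. \<exists>n.
        (\<forall>i<n. legal_query_round V \<alpha> \<nu> A x i \<and> x i \<in> nimue_move \<alpha> \<nu> A x i) \<and>
        ((\<exists>u\<in>A. arthur_move \<alpha> x n = Some (terminate u)) \<or>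
         legal_query_round V \<alpha> \<nu> A x n \<and> x n \<notin> nimue_move \<alpha> \<nu> A x n))"

definition LT_le_upper :: "nat set set \<Rightarrow> nat set set \<Rightarrow> bool" where
  "LT_le_upper U V \<longleftrightarrow> (\<exists>\<alpha> \<nu>. partial_computable \<alpha> \<and> winning U V \<alpha> \<nu>)"

definition LT_le :: "nat set set \<Rightarrow> nat set set \<Rightarrow> bool"  (infix "\<le>\<^sub>L\<^sub>T" 50) where
  "H \<le>\<^sub>L\<^sub>T I \<longleftrightarrow> LT_le_upper (dual H) (dual I)"

definition LT_less :: "nat set set \<Rightarrow> nat set set \<Rightarrow> bool"  (infix "<\<^sub>L\<^sub>T" 50) where
  "H <\<^sub>L\<^sub>T I \<longleftrightarrow> H \<le>\<^sub>L\<^sub>T I \<and> \<not> I \<le>\<^sub>L\<^sub>T H"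


section \<open>The lower sets\<close>

definition Fin :: "nat set set" where
  "Fin = {A. finite A}"

text \<open>The consecutive intervals: \<open>block a\<close> has length \<open>a\<close>, so it starts at \<open>0 + 1 + \<dots> + (a - 1)\<close>.\<close>

definition block :: "nat \<Rightarrow> nat set" where
  "block a = {\<Sum>{..<a} ..< \<Sum>{..a}}"

definition ED_fin_bd :: "nat \<Rightarrow> nat set set" where
  "ED_fin_bd m = {A. \<forall>\<^sub>\<infinity>n. card (A \<inter> block n) \<le> m}"

definition ED_fin :: "nat set set" where
  "ED_fin = (\<Union>m\<in>{1..}. ED_fin_bd m)"

definition Sum_inverse :: "nat set set" where
  "Sum_inverse = {A. (\<lambda>n. 1 / real n) summable_on {n \<in> A. n > 0}}"

end

theory Submission imports Defs "HOL-Analysis.Summation_Tests" begin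

text \<open>
  All four kinds of lower sets are linearly ordered by inclusion, and \<open>H \<subseteq> I\<close> gives
  \<open>H \<le>\<^sub>L\<^sub>T I\<close> at once: Nimue plays Merlin's own set \<open>A\<close> and Arthur outputs the reply
  (\<open>LT_le_of_subset\<close>). The work lies in the non-reductions.

  Suppose \<open>J \<le>\<^sub>L\<^sub>T I\<close>, where \<open>J\<close> contains all singletons. Fix Arthur's strategy and regard the finite
  sequences of replies as the nodes of a tree. For \<open>B \<in> J\<close>, Merlin wins from a node with the set \<open>- B\<close>
  if he can force either an output in \<open>B\<close> or that no legal output is ever made. Let \<open>L t\<close> be the set of
  labels \<open>l\<close> such that Merlin wins from \<open>t\<close> with \<open>- {l}\<close>; he is said to force \<open>l\<close> at \<open>t\<close>. Then \<open>L\<close> is empty at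
  the root. If \<open>L t\<close> is empty at a query node \<open>t\<close>, then either the children with \<open>L\<close> empty form a set
  outside \<open>I\<close>, so that Merlin can move to one of them, or the sets \<open>L\<close> of the children are \<open>spread\<close>: few
  of them are empty, and each label occurs in few of them. There are only countably many nodes of the latter
  kind, so one set \<open>B \<in> J\<close> may be built which meets, at every such node, \<open>I\<close>-positively many of the
  sets \<open>L (t @ [x])\<close>. With this \<open>B\<close> Merlin wins: he keeps \<open>L\<close> empty for as long as he can, and the
  first time he cannot he moves to a child at which some label of \<open>B\<close> is forced. This is
  \<open>not_LT_le_criterion\<close>.

  The set \<open>B\<close> is a union of finite sets \<open>F k\<close>, the \<open>k\<close>th of which serves one node and collects one
  label for each of \<open>h k\<close> children in a common large block. Spread families leave enough room to push these
  labels beyond any bound, so the \<open>F k\<close> can be made as sparse as desired (\<open>diagonal_selection\<close>). To escape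
  \<open>ED_fin_bd m\<close> one takes \<open>h k = m + 1\<close>; as distinct \<open>F k\<close> occupy distinct blocks, \<open>B\<close> lies in
  \<open>ED_fin_bd (m + 1)\<close>. To escape \<open>ED_fin\<close> one takes \<open>h k = k\<close>; as \<open>F k\<close> lies beyond \<open>k * 2 ^ k\<close>, the
  sum over \<open>F k\<close> is at most \<open>2\<close> to the power \<open>- k\<close> and \<open>B\<close> is summable. The bottom of the chain is
  the case \<open>m = 0\<close>, since \<open>Fin = ED_fin_bd 0\<close>.
\<close>


section \<open>Inclusions are reductions\<close>

lemma lower_setI:
  assumes "{} \<in> L" "\<And>A B. B \<in> L \<Longrightarrow> A \<subseteq> B \<Longrightarrow> A \<in> L" "UNIV \<notin> L"
  shows "lower_set L"
proof -
  have "B \<in> dual L" if AB: "A \<in> dual L" "A \<subseteq> B" for A B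
  proof -
    obtain C where C: "C \<in> L" "A = UNIV - C" using AB(1) by (auto simp: dual_def)
    then have "UNIV - B \<in> L" using assms(2)[of C "UNIV - B"] AB(2) by blast
    then show ?thesis by (auto simp: dual_def intro!: exI[of _ "UNIV - B"])
  qed
  moreover have "{} \<notin> dual L" using assms(3) by (auto simp: dual_def dest: top.extremum_uniqueI)
  moreover have "dual L \<noteq> {}" using assms(1) by (auto simp: dual_def)
  ultimately show ?thesis unfolding lower_set_def upper_set_def by blast
qed

lemma dual_iff: "A \<in> dual L \<longleftrightarrow> - A \<in> L"
  unfolding dual_def by (auto simp: Compl_eq_Diff_UNIV double_diff intro!: exI[of _ "UNIV - A"])

text \<open>Thanks to this coincidence of the two codings, the strategy that asks once and then outputs
  Merlin's reply is computed by fixing \<open>0\<close> and adding one to every positive code.\<close>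

lemma terminate_eq: "terminate x = Suc (list_encode [x])"
  by (simp add: terminate_def prod_encode_def)

lemma not_query_terminate: "\<not> query (terminate u)"
  by (auto simp: query_def terminate_def)

lemma terminate_inject: "terminate u = terminate v \<longleftrightarrow> u = v"
  by (simp add: terminate_def)

lemma eval_step: "eval (Comp Succ [Comp Succ [Proj 0]]) (n # xs) z \<longleftrightarrow> z = Suc (Suc n)"
proof
  assume "eval (Comp Succ [Comp Succ [Proj 0]]) (n # xs) z"
  then show "z = Suc (Suc n)"
    by (auto elim!: eval.cases[of "Comp _ _"] eval.cases[of Succ] eval.cases[of "Proj _"]
        simp: list_all2_Cons1)
next
  have "eval (Comp Succ [Proj 0]) (n # xs) (Suc n)"
    using eval.Proj[of 0 "n # xs"] by (intro eval.Comp[of _ _ "[n]"]) (auto intro: eval.Succ)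
  then show "z = Suc (Suc n) \<Longrightarrow> eval (Comp Succ [Comp Succ [Proj 0]]) (n # xs) z"
    by (auto intro: eval.Succ intro!: eval.Comp[of _ _ "[Suc n]"])
qed

lemma eval_identity_strategy:
  "eval (PrimRec Zero (Comp Succ [Comp Succ [Proj 0]])) [c] y \<longleftrightarrow> y = (if c = 0 then 0 else Suc c)"
proof (induction c arbitrary: y)
  case 0
  show ?case
    by (auto elim!: eval.cases[of "PrimRec _ _"] eval.cases[of Zero] intro: eval.PrimRec_0 eval.Zero)
next
  case (Suc c)
  let ?f = "PrimRec Zero (Comp Succ [Comp Succ [Proj 0]])"
  show ?case
  proof
    assume "eval ?f [Suc c] y"
    then obtain y' where "eval (Comp Succ [Comp Succ [Proj 0]]) (c # y' # []) y"
      by cases auto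
    then show "y = (if Suc c = 0 then 0 else Suc (Suc c))" by (simp add: eval_step)
  next
    have "eval ?f [c] (if c = 0 then 0 else Suc c)" by (simp only: Suc)
    then have "eval ?f [Suc c] (Suc (Suc c))" by (rule eval.PrimRec_Suc) (simp add: eval_step)
    then show "y = (if Suc c = 0 then 0 else Suc (Suc c)) \<Longrightarrow> eval ?f [Suc c] y" by simp
  qed
qed

text \<open>Nimue answers the only query with Merlin's set \<open>A\<close> itself, so any legal reply is a correct output.\<close>

lemma LT_le_of_subset:
  assumes "H \<subseteq> I"
  shows "H \<le>\<^sub>L\<^sub>T I"
proof -
  \<comment> \<open>The code \<open>0\<close> is the query \<open>\<langle>0,0\<rangle>\<close>; histories longer than one reply never arise.\<close>
  define \<alpha> :: arthur where "\<alpha> xs = Some (if xs = [] then 0 else Suc (list_encode xs))" for xs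
  define \<nu> :: nimue where "\<nu> A h q = A" for A h q
  have "list_encode xs = 0 \<longleftrightarrow> xs = []" for xs by (cases xs) auto
  then have "partial_computable \<alpha>"
    unfolding partial_computable_def \<alpha>_def
    by (intro exI[of _ "PrimRec Zero (Comp Succ [Comp Succ [Proj 0]])"]) (auto simp: eval_identity_strategy)
  moreover have "winning (dual H) (dual I) \<alpha> \<nu>"
    unfolding winning_def
  proof (intro ballI allI)
    fix A x assume A: "A \<in> dual H"
    have "query 0" unfolding query_def by (intro exI[of _ 0]) (simp add: prod_encode_def)
    then have q: "legal_query_round (dual I) \<alpha> \<nu> A x 0"
      using A assms by (auto simp: legal_query_round_def arthur_move_def \<alpha>_def \<nu>_def nimue_move_def dual_iff)
    show "\<exists>n. (\<forall>i<n. legal_query_round (dual I) \<alpha> \<nu> A x i \<and> x i \<in> nimue_move \<alpha> \<nu> A x i) \<and>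
        ((\<exists>u\<in>A. arthur_move \<alpha> x n = Some (terminate u)) \<or>
         legal_query_round (dual I) \<alpha> \<nu> A x n \<and> x n \<notin> nimue_move \<alpha> \<nu> A x n)"
    proof (cases "x 0 \<in> A")
      case True
      then show ?thesis using q
        by (intro exI[of _ 1]) (auto simp: nimue_move_def \<nu>_def arthur_move_def \<alpha>_def terminate_eq)
    next
      case False
      then show ?thesis using q
        by (intro exI[of _ 0]) (auto simp: nimue_move_def \<nu>_def)
    qed
  qed
  ultimately show ?thesis unfolding LT_le_def LT_le_upper_def by blast
qed

lemma LT_le_antimono_left:
  assumes "H \<subseteq> H'" "H' \<le>\<^sub>L\<^sub>T I"
  shows "H \<le>\<^sub>L\<^sub>T I"
proof -
  have "dual H \<subseteq> dual H'" using assms(1) by (auto simp: dual_iff)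
  then have "winning (dual H') V \<alpha> \<nu> \<Longrightarrow> winning (dual H) V \<alpha> \<nu>" for V \<alpha> \<nu>
    unfolding winning_def by blast
  then show ?thesis using assms(2) unfolding LT_le_def LT_le_upper_def by blast
qed


section \<open>A criterion for Merlin to win\<close>

text \<open>\<open>good I \<alpha> A s\<close> is the least fixed point describing the positions \<open>s\<close> from which Nimue can make
  \<open>\<alpha>\<close> output an element of \<open>A\<close>. Her move is the complement of the set \<open>N \<in> I\<close>.\<close>

inductive good :: "nat set set \<Rightarrow> arthur \<Rightarrow> nat set \<Rightarrow> nat list \<Rightarrow> bool" for I \<alpha> A where
  leaf: "\<alpha> s = Some (terminate u) \<Longrightarrow> u \<in> A \<Longrightarrow> good I \<alpha> A s"
| node: "\<alpha> s = Some a \<Longrightarrow> query a \<Longrightarrow> N \<in> I \<Longrightarrow> (\<And>x. x \<notin> N \<Longrightarrow> good I \<alpha> A (s @ [x])) \<Longrightarrow> good I \<alpha> A s"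

lemma good_mono: "good I \<alpha> A s \<Longrightarrow> A \<subseteq> B \<Longrightarrow> good I \<alpha> B s"
  by (induction rule: good.induct) (auto intro: good.intros)

lemma rounds_cong:
  "(\<And>i. i < n \<Longrightarrow> x i = y i) \<Longrightarrow> rounds \<alpha> \<nu> A x n = rounds \<alpha> \<nu> A y n"
proof (induction n)
  case (Suc n)
  have "map x [0..<n] = map y [0..<n]" using Suc.prems by auto
  then have "arthur_move \<alpha> x n = arthur_move \<alpha> y n" unfolding arthur_move_def by (rule arg_cong)
  then show ?case using Suc by (simp add: Let_def)
qed simp

text \<open>If the root is not good, Merlin defeats any Nimue by always replying so that the position stays not
  good: such a reply exists by the closure of \<open>good\<close> under \<open>good.node\<close>.\<close>

lemma good_root_of_winning:
  assumes win: "winning U (dual I) \<alpha> \<nu>" and "A \<in> U"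
  shows "good I \<alpha> A []"
proof (rule ccontr)
  assume root: "\<not> good I \<alpha> A []"
  define Q where "Q x n r \<longleftrightarrow> r \<in> nimue_move \<alpha> \<nu> A x n \<and> \<not> good I \<alpha> A (map x [0..<n] @ [r])"
    for x n r
  \<comment> \<open>Merlin's replies depend on the earlier ones, because Nimue's moves do.\<close>
  have "\<exists>x. \<forall>n. (\<exists>r. Q x n r) \<longrightarrow> Q x n (x n)"
  proof (rule dependent_wellorder_choice)
    fix r n and f g :: "nat \<Rightarrow> nat"
    assume "\<And>i. i < n \<Longrightarrow> f i = g i"
    then have "map f [0..<n] = map g [0..<n]" "rounds \<alpha> \<nu> A f n = rounds \<alpha> \<nu> A g n"
      by (auto intro!: rounds_cong)
    then have "Q f n = Q g n"
      unfolding Q_def nimue_move_def arthur_move_def by presburger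
    then show "((\<exists>r. Q f n r) \<longrightarrow> Q f n r) = ((\<exists>r. Q g n r) \<longrightarrow> Q g n r)"
      by simp
  qed auto
  then obtain x where x: "\<And>n. (\<exists>r. Q x n r) \<Longrightarrow> Q x n (x n)" by blast
  have reply: "Q x n (x n)"
    if legal: "legal_query_round (dual I) \<alpha> \<nu> A x n" and bad: "\<not> good I \<alpha> A (map x [0..<n])" for n
  proof (rule x, rule ccontr)
    assume "\<nexists>r. Q x n r"
    then have "good I \<alpha> A (map x [0..<n] @ [r])" if "r \<notin> - nimue_move \<alpha> \<nu> A x n" for r
      using that by (auto simp: Q_def)
    then have "good I \<alpha> A (map x [0..<n])"
      using legal by (auto simp: legal_query_round_def arthur_move_def dual_iff intro: good.node)
    with bad show False by blast
  qed
  obtain n where legal: "\<And>i. i < n \<Longrightarrow> legal_query_round (dual I) \<alpha> \<nu> A x i"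
    and fin: "(\<exists>u\<in>A. arthur_move \<alpha> x n = Some (terminate u)) \<or>
         legal_query_round (dual I) \<alpha> \<nu> A x n \<and> x n \<notin> nimue_move \<alpha> \<nu> A x n"
    using win[unfolded winning_def, rule_format, OF \<open>A \<in> U\<close>, of x] by blast
  have "\<not> good I \<alpha> A (map x [0..<i])" if "i \<le> n" for i
    using that
  proof (induction i)
    case 0
    then show ?case using root by simp
  next
    case (Suc i)
    then show ?case using reply[of i] legal[of i] by (auto simp: Q_def)
  qed
  then have bad: "\<not> good I \<alpha> A (map x [0..<n])" by simp
  from fin show False
  proof
    assume "\<exists>u\<in>A. arthur_move \<alpha> x n = Some (terminate u)"
    with bad show False by (auto simp: arthur_move_def intro: good.leaf)
  next
    assume "legal_query_round (dual I) \<alpha> \<nu> A x n \<and> x n \<notin> nimue_move \<alpha> \<nu> A x n"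
    with reply[OF _ bad] show False by (auto simp: Q_def)
  qed
qed

text \<open>With the members of \<open>I\<close> regarded as small sets of indices, almost all sets \<open>M x\<close> are inhabited, while
  every single label lies in only few of them.\<close>

definition spread :: "nat set set \<Rightarrow> (nat \<Rightarrow> nat set) \<Rightarrow> bool" where
  "spread I M \<longleftrightarrow> {x. M x = {}} \<in> I \<and> (\<forall>l. {x. l \<in> M x} \<in> I)"

text \<open>The hypothesis \<open>diag\<close> provides one \<open>B\<close> for all nodes of Arthur's tree. Given a position that is good
  for \<open>- B\<close>, induction on goodness shows that Merlin can force some single label there, which is impossible at
  the root.\<close>

theorem not_LT_le_criterion:
  assumes down: "\<And>A B. B \<in> I \<Longrightarrow> A \<subseteq> B \<Longrightarrow> A \<in> I"
    and singletons: "\<And>l. {l} \<in> J"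
    and diag: "\<And>M :: nat \<Rightarrow> nat \<Rightarrow> nat set.
      \<exists>B\<in>J. \<forall>i. spread I (M i) \<longrightarrow> {x. M i x \<inter> B \<noteq> {}} \<notin> I"
  shows "\<not> J \<le>\<^sub>L\<^sub>T I"
proof
  assume "J \<le>\<^sub>L\<^sub>T I"
  then obtain \<alpha> \<nu> where "winning (dual J) (dual I) \<alpha> \<nu>"
    unfolding LT_le_def LT_le_upper_def by blast
  then have root: "good I \<alpha> (- B) []" if "B \<in> J" for B
    using good_root_of_winning that by (simp add: dual_iff)
  \<comment> \<open>The labels Merlin can force from position \<open>t\<close>.\<close>
  define L where "L t = {l. \<not> good I \<alpha> (- {l}) t}" for t
  obtain B where B: "B \<in> J"
    and "\<And>i. spread I (\<lambda>x. L (list_decode i @ [x])) \<longrightarrow> {x. L (list_decode i @ [x]) \<inter> B \<noteq> {}} \<notin> I"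
    using diag[of "\<lambda>i x. L (list_decode i @ [x])"] by blast
  from this(2)[of "list_encode t" for t]
  have meets: "{x. L (t @ [x]) \<inter> B \<noteq> {}} \<notin> I" if "spread I (\<lambda>x. L (t @ [x]))" for t
    using that by simp
  have "L t \<noteq> {}" if "good I \<alpha> (- B) t" for t
    using that
  proof (induction rule: good.induct)
    case (leaf t u)
    have "\<not> good I \<alpha> (- {u}) t"
      using leaf not_query_terminate
      by (auto elim!: good.cases simp: terminate_inject)
    then show ?case by (auto simp: L_def)
  next
    case (node t a N)
    show ?case
    proof
      assume empty: "L t = {}"
      \<comment> \<open>Nimue can avoid each single label at \<open>t\<close>, so the children forcing it form a set in \<open>I\<close>; by the
        induction hypothesis the children without forced label lie in \<open>N\<close>.\<close>
      have "{x. l \<in> L (t @ [x])} \<in> I" for l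
      proof -
        have "good I \<alpha> (- {l}) t" using empty by (auto simp: L_def)
        then obtain N' where N': "N' \<in> I" "\<And>x. x \<notin> N' \<Longrightarrow> good I \<alpha> (- {l}) (t @ [x])"
          using node(1,2) not_query_terminate by (cases rule: good.cases) auto
        show ?thesis by (rule down[OF N'(1)]) (use N'(2) in \<open>auto simp: L_def\<close>)
      qed
      moreover have "{x. L (t @ [x]) = {}} \<in> I"
        by (rule down[OF node(3)]) (use node(5) in blast)
      ultimately have "{x. L (t @ [x]) \<inter> B \<noteq> {}} \<notin> I"
        by (intro meets) (simp add: spread_def)
      \<comment> \<open>A child at which a label of \<open>B\<close> is forced is not good for \<open>- B\<close>.\<close>
      moreover have "{x. L (t @ [x]) \<inter> B \<noteq> {}} \<subseteq> N"
        using node(4) good_mono[of I \<alpha> "- B" _ "- {l}" for l] by (fastforce simp: L_def)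
      ultimately show False using down[OF node(3)] by simp
    qed
  qed
  then have "L [] \<noteq> {}" using root B by blast
  then show False using root singletons by (auto simp: L_def)
qed


section \<open>Diagonalisation along the blocks\<close>

abbreviation start :: "nat \<Rightarrow> nat" where
  "start a \<equiv> \<Sum>{..<a}"

lemma block_eq: "block a = {start a..<start (Suc a)}"
  by (simp add: block_def lessThan_Suc_atMost)

lemma card_block: "card (block a) = a"
  by (simp add: block_eq)

lemma finite_block [simp]: "finite (block a)"
  by (simp add: block_def)

lemma start_mono: "a \<le> b \<Longrightarrow> start a \<le> start b"
  by (intro sum_mono2) auto

lemma le_start: "a \<le> Suc (start a)"
  by (induction a) auto

lemma start_real: "real (start a) = real a * (real a - 1) / 2"
  by (induction a) (auto simp: field_simps)

lemma ex_block: "\<exists>a. p \<in> block a"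
proof -
  define a where "a = (LEAST a. p < start (Suc a))"
  have "p < start (Suc (Suc p))" using le_start[of "Suc (Suc p)"] by linarith
  then have less: "p < start (Suc a)" unfolding a_def by (rule LeastI)
  have "start a \<le> p"
  proof (cases a)
    case (Suc b)
    then show ?thesis using not_less_Least[of b "\<lambda>a. p < start (Suc a)"] by (auto simp: a_def)
  qed simp
  with less show ?thesis by (auto simp: block_eq)
qed

lemma ED_fin_bd_iff: "A \<in> ED_fin_bd m \<longleftrightarrow> (\<exists>c. \<forall>n\<ge>c. card (A \<inter> block n) \<le> m)"
  by (simp add: ED_fin_bd_def MOST_nat_le)

lemma ED_fin_bd_mono: "m \<le> m' \<Longrightarrow> ED_fin_bd m \<subseteq> ED_fin_bd m'"
  unfolding ED_fin_bd_iff subset_iff by (meson order_trans)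

lemma ED_fin_iff: "A \<in> ED_fin \<longleftrightarrow> (\<exists>m. A \<in> ED_fin_bd m)"
proof
  assume "\<exists>m. A \<in> ED_fin_bd m"
  then obtain m where "A \<in> ED_fin_bd (Suc m)"
    using ED_fin_bd_mono[OF le_SucI[OF order_refl]] by blast
  then show "A \<in> ED_fin" by (auto simp: ED_fin_def)
qed (auto simp: ED_fin_def)

lemma ED_fin_bd_subset: "B \<in> ED_fin_bd m \<Longrightarrow> A \<subseteq> B \<Longrightarrow> A \<in> ED_fin_bd m"
  unfolding ED_fin_bd_iff by (meson card_mono finite_Int finite_block inf_mono order_refl order_trans)

lemma ED_fin_subset: "B \<in> ED_fin \<Longrightarrow> A \<subseteq> B \<Longrightarrow> A \<in> ED_fin"
  unfolding ED_fin_iff using ED_fin_bd_subset by blast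

lemma ED_fin_bd_finite:
  assumes "finite A"
  shows "A \<in> ED_fin_bd m"
  unfolding ED_fin_bd_iff
proof (intro exI allI impI)
  fix n assume "Suc (Suc (Max A)) \<le> n"
  then have "Max A < start n" using le_start[of n] by linarith
  then have "A \<inter> block n = {}" using assms Max_ge[OF assms] by (fastforce simp: block_eq)
  then show "card (A \<inter> block n) \<le> m" by simp
qed

lemma Fin_eq_ED_fin_bd_0: "Fin = ED_fin_bd 0"
proof -
  have "finite A" if A: "A \<in> ED_fin_bd 0" for A
  proof -
    obtain c where "\<And>n. n \<ge> c \<Longrightarrow> card (A \<inter> block n) = 0"
      using A unfolding ED_fin_bd_iff le_zero_eq by blast
    then have c: "A \<inter> block n = {}" if "n \<ge> c" for n using that by simp
    have "A \<subseteq> (\<Union>n<c. block n)"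
    proof
      fix p assume "p \<in> A"
      moreover obtain n where "p \<in> block n" using ex_block by blast
      ultimately show "p \<in> (\<Union>n<c. block n)" using c[of n] by (cases "c \<le> n") auto
    qed
    then show ?thesis by (rule finite_subset) auto
  qed
  then show ?thesis using ED_fin_bd_finite by (auto simp: Fin_def)
qed

lemma ED_fin_Un:
  assumes "A \<in> ED_fin" "B \<in> ED_fin"
  shows "A \<union> B \<in> ED_fin"
proof -
  obtain m c where A: "\<And>n. n \<ge> c \<Longrightarrow> card (A \<inter> block n) \<le> m"
    using assms(1) by (auto simp: ED_fin_iff ED_fin_bd_iff)
  obtain m' c' where B: "\<And>n. n \<ge> c' \<Longrightarrow> card (B \<inter> block n) \<le> m'"
    using assms(2) by (auto simp: ED_fin_iff ED_fin_bd_iff)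
  have "card ((A \<union> B) \<inter> block n) \<le> m + m'" if "n \<ge> max c c'" for n
    using A[of n] B[of n] that card_Un_le[of "A \<inter> block n" "B \<inter> block n"]
    by (simp add: Int_Un_distrib2)
  then show ?thesis unfolding ED_fin_iff ED_fin_bd_iff by blast
qed

text \<open>The indices \<open>x\<close> at which \<open>M x\<close> has no label from \<open>K\<close> onwards form a set in \<open>ED_fin\<close>, hence occupy
  boundedly many places in each large block, whereas the lengths of the blocks are unbounded.\<close>

lemma spread_large_labels:
  assumes "spread ED_fin M"
  obtains n X where "n \<ge> c" "X \<subseteq> block n" "card X = h" "\<And>x. x \<in> X \<Longrightarrow> \<exists>l\<ge>K. l \<in> M x"
proof -
  define N where "N K = {x. M x = {} \<or> (\<exists>l<K. l \<in> M x)}" for K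
  have "N K \<in> ED_fin"
  proof (induction K)
    case 0
    then show ?case using assms by (simp add: N_def spread_def)
  next
    case (Suc K)
    have "N (Suc K) = N K \<union> {x. K \<in> M x}" by (auto simp: N_def less_Suc_eq)
    then show ?case using Suc assms by (simp add: ED_fin_Un spread_def)
  qed
  then obtain m d where m: "\<And>n. n \<ge> d \<Longrightarrow> card (N K \<inter> block n) \<le> m"
    by (auto simp: ED_fin_iff ED_fin_bd_iff)
  define n where "n = c + d + m + h"
  have "card (block n - N K) = n - card (N K \<inter> block n)"
    by (subst card_Diff_subset_Int) (auto simp: card_block Int_commute)
  then have "h \<le> card (block n - N K)"
    using m[of n] by (simp add: n_def)
  then obtain X where X: "X \<subseteq> block n - N K" "card X = h"
    by (meson obtain_subset_with_card_n)
  show thesis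
  proof (rule that[of n X])
    show "\<exists>l\<ge>K. l \<in> M x" if "x \<in> X" for x
    proof -
      have "x \<notin> N K" using X(1) that by blast
      then show ?thesis by (auto simp: N_def not_less[symmetric])
    qed
  qed (use X in \<open>auto simp: n_def\<close>)
qed

text \<open>The growth of \<open>b\<close> controls the sparseness of the sets \<open>F k\<close>, and the intervals containing them are
  unions of blocks so that no block meets two of them. The last conclusion asks for large \<open>k\<close> as well as for large
  blocks \<open>n\<close> because \<open>h\<close> is allowed to grow.\<close>

lemma diagonal_selection:
  fixes M :: "nat \<Rightarrow> nat \<Rightarrow> nat set" and b h :: "nat \<Rightarrow> nat"
  obtains a F where "\<And>k. finite (F k)" "\<And>k. card (F k) \<le> h k" "mono a" "\<And>k. b k \<le> a k"
    "\<And>k. F k \<subseteq> {start (a k)..<start (a (Suc k))}"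
    "\<And>i c. spread ED_fin (M i) \<Longrightarrow>
      \<exists>k\<ge>c. \<exists>n\<ge>c. h k \<le> card ({x. M i x \<inter> F k \<noteq> {}} \<inter> block n)"
proof -
  \<comment> \<open>Stage \<open>k\<close> serves the family \<open>M (e k)\<close>; every index is served infinitely often.\<close>
  define e where "e k = fst (prod_decode k)" for k
  define P where "P k s \<longleftrightarrow> b k \<le> fst s \<and> finite (snd s) \<and> card (snd s) \<le> h k \<and>
      snd s \<subseteq> {start (fst s)..} \<and> (spread ED_fin (M (e k)) \<longrightarrow>
        (\<exists>n\<ge>k. h k \<le> card ({x. M (e k) x \<inter> snd s \<noteq> {}} \<inter> block n)))"
    for k and s :: "nat \<times> nat set"
  have ex: "\<exists>F. P k (a, F)" if "b k \<le> a" for k a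
  proof (cases "spread ED_fin (M (e k))")
    case True
    obtain n X where X: "n \<ge> k" "X \<subseteq> block n" "card X = h k"
      "\<And>x. x \<in> X \<Longrightarrow> \<exists>l\<ge>start a. l \<in> M (e k) x"
      using spread_large_labels[OF True] by blast
    then obtain l where l: "\<And>x. x \<in> X \<Longrightarrow> l x \<ge> start a \<and> l x \<in> M (e k) x"
      by metis
    have fin: "finite X" using X(2) by (rule finite_subset) simp
    have "X \<subseteq> {x. M (e k) x \<inter> l ` X \<noteq> {}} \<inter> block n" using X(2) l by blast
    from card_mono[OF _ this] have "h k \<le> card ({x. M (e k) x \<inter> l ` X \<noteq> {}} \<inter> block n)"
      using X(3) by simp
    then show ?thesis
      using that X(1,3) fin l card_image_le[OF fin, of l] by (intro exI[of _ "l ` X"]) (auto simp: P_def)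
  next
    case False
    then show ?thesis using that by (intro exI[of _ "{}"]) (auto simp: P_def)
  qed
  have "\<exists>f. \<forall>k. P k (f k) \<and> fst (f k) \<le> fst (f (Suc k)) \<and>
      snd (f k) \<subseteq> {..<start (fst (f (Suc k)))}"
  proof (rule dependent_nat_choice)
    show "\<exists>s. P 0 s" using ex[of 0 "b 0"] by blast
    fix s k assume "P k s"
    then have fin: "finite (snd s)" by (simp add: P_def)
    define a where "a = Max {b (Suc k), fst s, Suc (Suc (Max (snd s)))}"
    have "Max (snd s) < start a" using le_start[of a] by (simp add: a_def)
    then have "snd s \<subseteq> {..<start a}" using Max_ge[OF fin] by fastforce
    moreover obtain F where "P (Suc k) (a, F)" using ex[of "Suc k" a] by (auto simp: a_def)
    ultimately show "\<exists>s'. P (Suc k) s' \<and> fst s \<le> fst s' \<and> snd s \<subseteq> {..<start (fst s')}"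
      by (intro exI[of _ "(a, F)"]) (auto simp: a_def)
  qed
  then obtain f where f: "\<And>k. P k (f k)" "\<And>k. snd (f k) \<subseteq> {..<start (fst (f (Suc k)))}"
    "\<And>k. fst (f k) \<le> fst (f (Suc k))"
    by blast
  show thesis
  proof (rule that[of "\<lambda>k. snd (f k)" "\<lambda>k. fst (f k)"])
    fix i c assume sp: "spread ED_fin (M i)"
    define k where "k = prod_encode (i, c)"
    have k: "e k = i" "c \<le> k" by (simp_all add: e_def k_def le_prod_encode_2)
    then obtain n where "n \<ge> k" "h k \<le> card ({x. M i x \<inter> snd (f k) \<noteq> {}} \<inter> block n)"
      using f(1)[of k] sp by (auto simp: P_def)
    then show "\<exists>k\<ge>c. \<exists>n\<ge>c. h k \<le> card ({x. M i x \<inter> snd (f k) \<noteq> {}} \<inter> block n)"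
      using k by (meson order_trans)
  next
    show "mono (\<lambda>k. fst (f k))" using f(3) by (simp add: mono_iff_le_Suc)
    fix k
    show "snd (f k) \<subseteq> {start (fst (f k))..<start (fst (f (Suc k)))}"
      using f(1)[of k] f(2)[of k] by (auto simp: P_def)
  qed (use f(1) in \<open>auto simp: P_def\<close>)
qed

lemma card_meets_mono:
  assumes "F \<subseteq> B"
  shows "card ({x. M x \<inter> F \<noteq> {}} \<inter> block n) \<le> card ({x. M x \<inter> B \<noteq> {}} \<inter> block n)"
  using assms by (intro card_mono) auto

theorem ED_fin_bd_Suc_not_le: "\<not> ED_fin_bd (Suc m) \<le>\<^sub>L\<^sub>T ED_fin_bd m"
proof (rule not_LT_le_criterion)
  fix M :: "nat \<Rightarrow> nat \<Rightarrow> nat set"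
  obtain a F where fin: "\<And>k. finite (F k)" and card: "\<And>k. card (F k) \<le> Suc m"
    and mono: "mono a"
    and F: "\<And>k. F k \<subseteq> {start (a k)..<start (a (Suc k))}"
    and meets: "\<And>i c. spread ED_fin (M i) \<Longrightarrow>
      \<exists>k\<ge>c. \<exists>n\<ge>c. Suc m \<le> card ({x. M i x \<inter> F k \<noteq> {}} \<inter> block n)"
    using diagonal_selection[of "\<lambda>_. Suc m" "\<lambda>_. 0" M] by metis
  \<comment> \<open>A block meets at most one of the sets \<open>F k\<close>.\<close>
  have range: "a k \<le> n \<and> n < a (Suc k)" if "p \<in> F k" "p \<in> block n" for k n p
    using F[of k] that start_mono[of "Suc n" "a k"] start_mono[of "a (Suc k)" n]
    by (fastforce simp: block_eq not_le simp flip: Suc_le_eq)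
  have unique: "k' \<le> k" if "p \<in> F k" "p \<in> block n" "p' \<in> F k'" "p' \<in> block n" for k k' n p p'
    using range[of p k n] range[of p' k' n] that monoD[OF mono, of "Suc k" k'] by fastforce
  have "(\<Union>k. F k) \<in> ED_fin_bd (Suc m)"
    unfolding ED_fin_bd_iff
  proof (intro exI allI impI)
    fix n :: nat assume "0 \<le> n"
    show "card ((\<Union>k. F k) \<inter> block n) \<le> Suc m"
    proof (cases "\<exists>k p. p \<in> F k \<inter> block n")
      case True
      then obtain k p where k: "p \<in> F k" "p \<in> block n" by blast
      have "(\<Union>k. F k) \<inter> block n \<subseteq> F k"
        using unique[OF k] unique[OF _ _ k] by (fastforce dest: le_antisym)
      then show ?thesis using card_mono[OF fin] card[of k] by (meson order_trans)
    next
      case False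
      then have "(\<Union>k. F k) \<inter> block n = {}" by blast
      then show ?thesis by simp
    qed
  qed
  moreover have "{x. M i x \<inter> (\<Union>k. F k) \<noteq> {}} \<notin> ED_fin_bd m" if "spread (ED_fin_bd m) (M i)" for i
  proof
    assume "{x. M i x \<inter> (\<Union>k. F k) \<noteq> {}} \<in> ED_fin_bd m"
    then obtain c where c: "\<And>n. n \<ge> c \<Longrightarrow> card ({x. M i x \<inter> (\<Union>k. F k) \<noteq> {}} \<inter> block n) \<le> m"
      by (auto simp: ED_fin_bd_iff)
    have "spread ED_fin (M i)" using that by (auto simp: spread_def ED_fin_iff)
    from meets[OF this, of c] obtain k n where
      "n \<ge> c" "Suc m \<le> card ({x. M i x \<inter> F k \<noteq> {}} \<inter> block n)" by blast
    then show False using c[of n] card_meets_mono[of "F k" "\<Union>k. F k" "M i" n] by fastforce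
  qed
  ultimately show "\<exists>B\<in>ED_fin_bd (Suc m). \<forall>i. spread (ED_fin_bd m) (M i) \<longrightarrow>
      {x. M i x \<inter> B \<noteq> {}} \<notin> ED_fin_bd m"
    by blast
next
  show "{l} \<in> ED_fin_bd (Suc m)" for l by (simp add: ED_fin_bd_finite)
qed (rule ED_fin_bd_subset)


section \<open>The summable ideal\<close>

lemma Sum_inverse_iff: "A \<in> Sum_inverse \<longleftrightarrow> (\<lambda>n. 1 / real n) summable_on A"
  unfolding Sum_inverse_def mem_Collect_eq by (rule summable_on_cong_neutral) auto

lemma Sum_inverse_subset: "B \<in> Sum_inverse \<Longrightarrow> A \<subseteq> B \<Longrightarrow> A \<in> Sum_inverse"
  unfolding Sum_inverse_iff by (rule summable_on_subset_banach)

lemma Sum_inverse_UNIV: "UNIV \<notin> Sum_inverse"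
proof
  assume "UNIV \<in> Sum_inverse"
  then have "summable (\<lambda>n. 1 / real n)"
    unfolding Sum_inverse_iff by (rule summable_on_imp_summable)
  then show False using not_summable_harmonic[where 'a = real] by (simp add: inverse_eq_divide)
qed

text \<open>Both the inclusion of \<open>ED_fin\<close> and the summability of the diagonal set are obtained by splitting a
  set into finite pieces. The term at \<open>p = 0\<close> is \<open>1 / 0 = 0\<close>.\<close>

lemma Sum_inverse_UnionI:
  fixes F :: "nat \<Rightarrow> nat set"
  assumes fin: "\<And>k. finite (F k)" and sums: "summable (\<lambda>k. \<Sum>p\<in>F k. 1 / real p)"
  shows "(\<Union>k. F k) \<in> Sum_inverse"
  unfolding Sum_inverse_iff
proof (rule nonneg_bdd_above_summable_on)
  show "bdd_above (sum (\<lambda>n. 1 / real n) ` {G. G \<subseteq> (\<Union>k. F k) \<and> finite G})"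
  proof (rule bdd_aboveI2)
    fix G assume "G \<in> {G. G \<subseteq> (\<Union>k. F k) \<and> finite G}"
    then have G: "finite G" "G \<subseteq> (\<Union>k. F k)" by auto
    then have "\<forall>p\<in>G. \<exists>k. p \<in> F k" by blast
    then obtain \<kappa> where \<kappa>: "\<forall>p\<in>G. p \<in> F (\<kappa> p)" by (rule bchoice[THEN exE])
    define K where "K = \<kappa> ` G"
    have K: "finite K" "G \<subseteq> (\<Union>k\<in>K. F k)" using G(1) \<kappa> by (auto simp: K_def)
    have "sum (\<lambda>n. 1 / real n) G \<le> sum (\<lambda>n. 1 / real n) (\<Union>k\<in>K. F k)"
      using K fin by (intro sum_mono2) auto
    also have "\<dots> \<le> (\<Sum>k\<in>K. \<Sum>p\<in>F k. 1 / real p)"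
      using K(1)
    proof (induction K rule: finite_induct)
      case (insert k K)
      have "sum (\<lambda>n. 1 / real n) (F k \<union> (\<Union>k\<in>K. F k)) \<le>
          sum (\<lambda>n. 1 / real n) (F k) + sum (\<lambda>n. 1 / real n) (\<Union>k\<in>K. F k)"
        using insert.hyps fin by (subst sum.union_inter[symmetric]) (auto intro!: sum_nonneg)
      then show ?case using insert by simp
    qed simp
    also have "\<dots> \<le> (\<Sum>k. \<Sum>p\<in>F k. 1 / real p)"
      by (intro sum_le_suminf sums K(1)) (auto intro: sum_nonneg)
    finally show "sum (\<lambda>n. 1 / real n) G \<le> (\<Sum>k. \<Sum>p\<in>F k. 1 / real p)" .
  qed
qed simp

text \<open>The elements of the \<open>n\<close>th block are of order \<open>n\<^sup>2\<close>, so that a bounded number of points per block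
  contributes a series dominated by a multiple of the sum of \<open>1 / n\<^sup>2\<close>.\<close>

lemma ED_fin_subset_Sum_inverse: "ED_fin \<subseteq> Sum_inverse"
proof
  fix A assume "A \<in> ED_fin"
  then obtain m c where m: "\<And>n. n \<ge> c \<Longrightarrow> card (A \<inter> block n) \<le> m"
    by (auto simp: ED_fin_iff ED_fin_bd_iff)
  have "summable (\<lambda>n. \<Sum>p\<in>A \<inter> block n. 1 / real p)"
  proof (rule summable_comparison_test_ev)
    show "\<forall>\<^sub>F n in sequentially. norm (\<Sum>p\<in>A \<inter> block n. 1 / real p) \<le> 4 * real m * inverse (real n ^ 2)"
      using eventually_ge_at_top[of "max c 2"]
    proof eventually_elim
      case (elim n)
      have "real n * (real n / 2) \<le> real n * (real n - 1)"
        using elim by (intro mult_left_mono) auto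
      then have start: "(real n)\<^sup>2 / 4 \<le> real (start n)"
        unfolding start_real power2_eq_square by simp
      have "1 / real p \<le> 4 * inverse (real n ^ 2)" if "p \<in> block n" for p
      proof -
        have "(real n)\<^sup>2 / 4 \<le> real p" using start that
          by (simp add: block_eq del: of_nat_sum)
        then have "1 / real p \<le> 1 / ((real n)\<^sup>2 / 4)" using elim by (intro frac_le) auto
        then show ?thesis by (simp add: inverse_eq_divide)
      qed
      then have "(\<Sum>p\<in>A \<inter> block n. 1 / real p) \<le> real (card (A \<inter> block n)) * (4 * inverse (real n ^ 2))"
        by (intro sum_bounded_above) auto
      also have "\<dots> \<le> real m * (4 * inverse (real n ^ 2))"
        using m[of n] elim by (intro mult_right_mono) auto
      finally show ?case by (simp add: sum_nonneg mult_ac)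
    qed
    show "summable (\<lambda>n. 4 * real m * inverse (real n ^ 2))"
      by (intro summable_mult inverse_power_summable) simp
  qed
  then have "(\<Union>n. A \<inter> block n) \<in> Sum_inverse" by (intro Sum_inverse_UnionI) auto
  moreover have "A \<subseteq> (\<Union>n. A \<inter> block n)" using ex_block by auto
  ultimately show "A \<in> Sum_inverse" by (rule Sum_inverse_subset)
qed

theorem Sum_inverse_not_le_ED_fin: "\<not> Sum_inverse \<le>\<^sub>L\<^sub>T ED_fin"
proof (rule not_LT_le_criterion)
  fix M :: "nat \<Rightarrow> nat \<Rightarrow> nat set"
  obtain a F where fin: "\<And>k. finite (F k)" and card: "\<And>k. card (F k) \<le> k"
    and a: "\<And>k. Suc (k * 2 ^ k) \<le> a k" and F: "\<And>k. F k \<subseteq> {start (a k)..<start (a (Suc k))}"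
    and meets: "\<And>i c. spread ED_fin (M i) \<Longrightarrow>
      \<exists>k\<ge>c. \<exists>n\<ge>c. k \<le> card ({x. M i x \<inter> F k \<noteq> {}} \<inter> block n)"
    using diagonal_selection[of "\<lambda>k. k" "\<lambda>k. Suc (k * 2 ^ k)" M] by metis
  have "(\<Union>k. F k) \<in> Sum_inverse"
  proof (rule Sum_inverse_UnionI[OF fin summable_comparison_test'])
    show "summable (\<lambda>k. (1 / 2 :: real) ^ k)" by (simp add: summable_geometric)
    fix k :: nat assume k: "k \<ge> 1"
    have "1 / real p \<le> 1 / (real k * 2 ^ k)" if "p \<in> F k" for p
    proof -
      have "k * 2 ^ k \<le> p" using F[of k] that a[of k] le_start[of "a k"] by fastforce
      then have "real k * 2 ^ k \<le> real p"
        by (metis of_nat_le_iff of_nat_mult of_nat_numeral of_nat_power)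
      then show ?thesis using k by (intro frac_le) auto
    qed
    then have "(\<Sum>p\<in>F k. 1 / real p) \<le> real (card (F k)) * (1 / (real k * 2 ^ k))"
      by (intro sum_bounded_above) auto
    also have "\<dots> \<le> real k * (1 / (real k * 2 ^ k))"
      using card[of k] by (intro mult_right_mono) auto
    also have "\<dots> = (1 / 2) ^ k" using k by (simp add: power_divide)
    finally show "norm (\<Sum>p\<in>F k. 1 / real p) \<le> (1 / 2) ^ k" by (simp add: sum_nonneg)
  qed
  moreover have "{x. M i x \<inter> (\<Union>k. F k) \<noteq> {}} \<notin> ED_fin" if "spread ED_fin (M i)" for i
  proof
    assume "{x. M i x \<inter> (\<Union>k. F k) \<noteq> {}} \<in> ED_fin"
    then obtain m c where c: "\<And>n. n \<ge> c \<Longrightarrow> card ({x. M i x \<inter> (\<Union>k. F k) \<noteq> {}} \<inter> block n) \<le> m"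
      by (auto simp: ED_fin_iff ED_fin_bd_iff)
    from meets[OF that, of "max c (Suc m)"] obtain k n where
      "k \<ge> Suc m" "n \<ge> c" "k \<le> card ({x. M i x \<inter> F k \<noteq> {}} \<inter> block n)" by auto
    then show False using c[of n] card_meets_mono[of "F k" "\<Union>k. F k" "M i" n] by fastforce
  qed
  ultimately show "\<exists>B\<in>Sum_inverse. \<forall>i. spread ED_fin (M i) \<longrightarrow>
      {x. M i x \<inter> B \<noteq> {}} \<notin> ED_fin"
    by blast
next
  show "{l} \<in> Sum_inverse" for l by (simp add: Sum_inverse_iff)
qed (rule ED_fin_subset)


section \<open>The chain\<close>

theorem corollary5p17:
  shows "lower_set Fin \<and> (\<forall>m\<ge>1. lower_set (ED_fin_bd m)) \<and> lower_set ED_fin \<and> lower_set Sum_inverse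
    \<and> Fin <\<^sub>L\<^sub>T ED_fin_bd 1
    \<and> (\<forall>m\<ge>1. ED_fin_bd m <\<^sub>L\<^sub>T ED_fin_bd (m + 1))
    \<and> (\<forall>m\<ge>1. ED_fin_bd m <\<^sub>L\<^sub>T ED_fin)
    \<and> ED_fin <\<^sub>L\<^sub>T Sum_inverse"
proof -
  have bd_sub: "ED_fin_bd m \<subseteq> ED_fin" for m by (auto simp: ED_fin_iff)
  have ED_UNIV: "UNIV \<notin> ED_fin"
    using ED_fin_subset_Sum_inverse Sum_inverse_UNIV by (rule contra_subsetD)
  have bd: "lower_set (ED_fin_bd m)" for m
  proof (rule lower_setI)
    show "UNIV \<notin> ED_fin_bd m" using bd_sub ED_UNIV by (rule contra_subsetD)
  qed (simp add: ED_fin_bd_finite, rule ED_fin_bd_subset)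
  have ED: "lower_set ED_fin"
  proof (rule lower_setI)
    show "{} \<in> ED_fin" using bd_sub ED_fin_bd_finite[OF finite.emptyI] by (rule subsetD)
  qed (rule ED_fin_subset, assumption+, rule ED_UNIV)
  have Sum: "lower_set Sum_inverse"
  proof (rule lower_setI)
    show "{} \<in> Sum_inverse" by (simp add: Sum_inverse_iff)
  qed (rule Sum_inverse_subset, assumption+, rule Sum_inverse_UNIV)
  have bd_less: "ED_fin_bd m <\<^sub>L\<^sub>T ED_fin_bd (m + 1)" for m
    unfolding LT_less_def using ED_fin_bd_Suc_not_le LT_le_of_subset ED_fin_bd_mono by simp
  have bd_less_ED: "ED_fin_bd m <\<^sub>L\<^sub>T ED_fin" for m
    unfolding LT_less_def
    using LT_le_of_subset[OF bd_sub[of m]]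
      LT_le_antimono_left[OF bd_sub[of "Suc m"]] ED_fin_bd_Suc_not_le[of m] by blast
  have "ED_fin <\<^sub>L\<^sub>T Sum_inverse"
    unfolding LT_less_def
    using LT_le_of_subset[OF ED_fin_subset_Sum_inverse] Sum_inverse_not_le_ED_fin by blast
  then show ?thesis
    using bd ED Sum bd_less bd_less_ED bd_less[of 0] unfolding Fin_eq_ED_fin_bd_0 add_0 by blast
qed

end
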